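(* Let $A$ be a Banach algebra, let $n\ge 0$ be an even integer, and let $T,S:A^{(n)}\to A^{(n)}$ be continuous linear mappings. Assume that $A^{(n+2)}$ has the $T$-$w^*w$ property. If $A^{(n+2)}$ is weakly $T''$-$S''$-amenable, then $A^{(n)}$ is weakly $T$-$S$-amenable.
   Context: $A^{(n)}$ denotes the $n$-th dual of $A$, with $A^{(0)}=A$; a space is regarded as a subspace of its second dual via the canonical embedding. For a bounded linear map $T$, $T''$ is its second adjoint. For a Banach algebra $B$, the first Arens product on $B^{**}$ is defined by $\langle b'b,c\rangle=\langle b',bc\rangle$, $\langle b''b',b\rangle=\langle b'',b'b\rangle$, $\langle a''b'',b'\rangle=\langle a'',b''b'\rangle$ for $b,c\in B$, $b'\in B^*$, $a'',b''\in B^{**}$. For even $n$, $A^{(n)}$ is a Banach algebra under the iterated first Arens product ($A^{(n+2)}=(A^{(n)})^{**}$ carries the first Arens product). If $B$ is a Banach algebra, $B^*$ is the dual $B$-bimodule: $\langle b'a,c\rangle=\langle b',ac\rangle$, $\langle ab',c\rangle=\langle b',ca\rangle$. Let $B$ be a Banach algebra, $X$ a Banach $B$-bimodule, and $T,S:B\to B$ continuous linear maps. A bounded linear map $D:B\to X$ is a $T$-$S$-derivation if $D(xy)=T(x)D(y)+D(x)S(y)$ for all $x,y\in B$. It is an inner $T$-$S$-derivation if there is $x\in X$ with $D(a)=T(a)x-xS(a)$ for all $a\in B$. $B$ is weakly $T$-$S$-amenable if every $T$-$S$-derivation from $B$ into $B^*$ is an inner $T$-$S$-derivation. For $T:B\to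 B$ continuous linear, $a''\in B^{**}$ has the $T$-$w^*w$ property if the map $b''\mapsto a''T''(b'')$, $B^{**}\to B^{**}$, is weak$^*$-to-weak continuous (weak$^*$ topology $\sigma(B^{**},B^* )$, weak topology $\sigma(B^{**},B^{***})$); a subset of $B^{**}$ has the $T$-$w^*w$ property if each of its elements does. Here this is applied with $B=A^{(n)}$, $B^{**}=A^{(n+2)}$. *)

theory Defs
  imports "HOL-Analysis.Analysis"
begin

text \<open>
  The \<open>n\<close>-th dual of a space cannot be a type depending on \<open>n\<close>, so normed spaces are records
  with an explicit carrier. The scalar field is any type of class \<open>real_normed_field\<close>; by the
  theorems of Ostrowski and Mazur its instances are, up to isometric isomorphism, \<open>real\<close> and
  \<open>complex\<close>, so that real and complex Banach algebras are both covered.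
\<close>

section \<open>Banach spaces and Banach algebras on a carrier set\<close>

record ('k, 'a) nspace =
  vcarrier :: "'a set"
  vadd :: "'a \<Rightarrow> 'a \<Rightarrow> 'a"
  vzero :: "'a"
  vscale :: "'k \<Rightarrow> 'a \<Rightarrow> 'a"
  vnorm :: "'a \<Rightarrow> real"

record ('k, 'a) nalgebra = "('k, 'a) nspace" +
  amult :: "'a \<Rightarrow> 'a \<Rightarrow> 'a"

record ('k, 'x, 'b) bimodule = "('k, 'x) nspace" +
  lact :: "'b \<Rightarrow> 'x \<Rightarrow> 'x"
  ract :: "'x \<Rightarrow> 'b \<Rightarrow> 'x"

definition vminus :: "('k::real_normed_field, 'a, 'm) nspace_scheme \<Rightarrow> 'a \<Rightarrow> 'a \<Rightarrow> 'a"
  where "vminus X x y = vadd X x (vscale X (- 1) y)"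

locale normed_space =
  fixes X :: "('k::real_normed_field, 'a, 'm) nspace_scheme"
  assumes add_closed: "\<lbrakk>x \<in> vcarrier X; y \<in> vcarrier X\<rbrakk> \<Longrightarrow> vadd X x y \<in> vcarrier X"
    and zero_closed: "vzero X \<in> vcarrier X"
    and scale_closed: "x \<in> vcarrier X \<Longrightarrow> vscale X c x \<in> vcarrier X"
    and add_assoc: "\<lbrakk>x \<in> vcarrier X; y \<in> vcarrier X; z \<in> vcarrier X\<rbrakk>
      \<Longrightarrow> vadd X (vadd X x y) z = vadd X x (vadd X y z)"
    and add_commute: "\<lbrakk>x \<in> vcarrier X; y \<in> vcarrier X\<rbrakk> \<Longrightarrow> vadd X x y = vadd X y x"
    and add_zero: "x \<in> vcarrier X \<Longrightarrow> vadd X x (vzero X) = x"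
    and add_inverse: "x \<in> vcarrier X \<Longrightarrow> \<exists>y\<in>vcarrier X. vadd X x y = vzero X"
    and scale_add_right: "\<lbrakk>x \<in> vcarrier X; y \<in> vcarrier X\<rbrakk>
      \<Longrightarrow> vscale X c (vadd X x y) = vadd X (vscale X c x) (vscale X c y)"
    and scale_add_left: "x \<in> vcarrier X
      \<Longrightarrow> vscale X (c + d) x = vadd X (vscale X c x) (vscale X d x)"
    and scale_scale: "x \<in> vcarrier X \<Longrightarrow> vscale X c (vscale X d x) = vscale X (c * d) x"
    and scale_one: "x \<in> vcarrier X \<Longrightarrow> vscale X 1 x = x"
    and norm_nonneg: "x \<in> vcarrier X \<Longrightarrow> vnorm X x \<ge> 0"
    and norm_eq_zero: "x \<in> vcarrier X \<Longrightarrow> vnorm X x = 0 \<longleftrightarrow> x = vzero X"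
    and norm_scale: "x \<in> vcarrier X \<Longrightarrow> vnorm X (vscale X c x) = norm c * vnorm X x"
    and norm_triangle: "\<lbrakk>x \<in> vcarrier X; y \<in> vcarrier X\<rbrakk>
      \<Longrightarrow> vnorm X (vadd X x y) \<le> vnorm X x + vnorm X y"

locale banach_space = normed_space +
  assumes complete: "\<lbrakk>\<And>i. s i \<in> vcarrier X;
      \<And>e. e > 0 \<Longrightarrow> \<exists>N::nat. \<forall>i\<ge>N. \<forall>j\<ge>N. vnorm X (vminus X (s i) (s j)) < e\<rbrakk>
    \<Longrightarrow> \<exists>l\<in>vcarrier X. (\<lambda>i. vnorm X (vminus X (s i) l)) \<longlonglongrightarrow> 0"

locale normed_algebra = normed_space X
  for X :: "('k::real_normed_field, 'a, 'm) nalgebra_scheme" +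
  assumes mult_closed: "\<lbrakk>x \<in> vcarrier X; y \<in> vcarrier X\<rbrakk> \<Longrightarrow> amult X x y \<in> vcarrier X"
    and mult_assoc: "\<lbrakk>x \<in> vcarrier X; y \<in> vcarrier X; z \<in> vcarrier X\<rbrakk>
      \<Longrightarrow> amult X (amult X x y) z = amult X x (amult X y z)"
    and mult_add_left: "\<lbrakk>x \<in> vcarrier X; y \<in> vcarrier X; z \<in> vcarrier X\<rbrakk>
      \<Longrightarrow> amult X (vadd X x y) z = vadd X (amult X x z) (amult X y z)"
    and mult_add_right: "\<lbrakk>x \<in> vcarrier X; y \<in> vcarrier X; z \<in> vcarrier X\<rbrakk>
      \<Longrightarrow> amult X x (vadd X y z) = vadd X (amult X x y) (amult X x z)"
    and mult_scale_left: "\<lbrakk>x \<in> vcarrier X; y \<in> vcarrier X\<rbrakk>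
      \<Longrightarrow> amult X (vscale X c x) y = vscale X c (amult X x y)"
    and mult_scale_right: "\<lbrakk>x \<in> vcarrier X; y \<in> vcarrier X\<rbrakk>
      \<Longrightarrow> amult X x (vscale X c y) = vscale X c (amult X x y)"
    and norm_mult_le: "\<lbrakk>x \<in> vcarrier X; y \<in> vcarrier X\<rbrakk>
      \<Longrightarrow> vnorm X (amult X x y) \<le> vnorm X x * vnorm X y"

locale banach_algebra = normed_algebra X + banach_space X
  for X :: "('k::real_normed_field, 'a, 'm) nalgebra_scheme"

section \<open>Bounded linear maps, duals and adjoints\<close>

definition bounded_linear_map ::
  "('k::real_normed_field, 'a, 'm) nspace_scheme \<Rightarrow> ('k, 'b, 'n) nspace_scheme \<Rightarrow> ('a \<Rightarrow> 'b) \<Rightarrow> bool"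
  where "bounded_linear_map X Y T \<longleftrightarrow>
    T \<in> vcarrier X \<rightarrow> vcarrier Y \<and>
    (\<forall>x\<in>vcarrier X. \<forall>y\<in>vcarrier X. T (vadd X x y) = vadd Y (T x) (T y)) \<and>
    (\<forall>c. \<forall>x\<in>vcarrier X. T (vscale X c x) = vscale Y c (T x)) \<and>
    (\<exists>K. \<forall>x\<in>vcarrier X. vnorm Y (T x) \<le> K * vnorm X x)"

definition scalars :: "('k::real_normed_field, 'k) nspace"
  where "scalars = \<lparr>vcarrier = UNIV, vadd = (+), vzero = 0, vscale = (*), vnorm = norm\<rparr>"

definition dual :: "('k::real_normed_field, 'a, 'm) nspace_scheme \<Rightarrow> ('k, 'a \<Rightarrow> 'k) nspace"
  where "dual X =
    \<lparr>vcarrier = {f \<in> extensional (vcarrier X). bounded_linear_map X scalars f},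
     vadd = (\<lambda>f g. \<lambda>x\<in>vcarrier X. f x + g x),
     vzero = (\<lambda>x\<in>vcarrier X. 0),
     vscale = (\<lambda>c f. \<lambda>x\<in>vcarrier X. c * f x),
     vnorm = (\<lambda>f. SUP x\<in>{x \<in> vcarrier X. vnorm X x \<le> 1}. norm (f x))\<rparr>"

definition adjoint :: "('k::real_normed_field, 'a, 'm) nspace_scheme \<Rightarrow>
    ('k, 'b, 'n) nspace_scheme \<Rightarrow> ('a \<Rightarrow> 'b) \<Rightarrow> ('b \<Rightarrow> 'k) \<Rightarrow> ('a \<Rightarrow> 'k)"
  where "adjoint X Y T = (\<lambda>g\<in>vcarrier (dual Y). \<lambda>x\<in>vcarrier X. g (T x))"

definition second_adjoint :: "('k::real_normed_field, 'a, 'm) nspace_scheme \<Rightarrow>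
    ('k, 'b, 'n) nspace_scheme \<Rightarrow> ('a \<Rightarrow> 'b) \<Rightarrow> (('a \<Rightarrow> 'k) \<Rightarrow> 'k) \<Rightarrow> (('b \<Rightarrow> 'k) \<Rightarrow> 'k)"
  where "second_adjoint X Y T = adjoint (dual Y) (dual X) (adjoint X Y T)"

section \<open>The first Arens product and the dual bimodule\<close>

definition dual_ract :: "('k::real_normed_field, 'b, 'm) nalgebra_scheme \<Rightarrow>
    ('b \<Rightarrow> 'k) \<Rightarrow> 'b \<Rightarrow> ('b \<Rightarrow> 'k)"
  where "dual_ract B f b = (\<lambda>c\<in>vcarrier B. f (amult B b c))"

definition dual_lact :: "('k::real_normed_field, 'b, 'm) nalgebra_scheme \<Rightarrow>
    'b \<Rightarrow> ('b \<Rightarrow> 'k) \<Rightarrow> ('b \<Rightarrow> 'k)"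
  where "dual_lact B b f = (\<lambda>c\<in>vcarrier B. f (amult B c b))"

definition dual_bimodule ::
  "('k::real_normed_field, 'b, 'm) nalgebra_scheme \<Rightarrow> ('k, 'b \<Rightarrow> 'k, 'b) bimodule"
  where "dual_bimodule B = nspace.extend (dual B) (bimodule.fields (dual_lact B) (dual_ract B))"

definition arens_act :: "('k::real_normed_field, 'b, 'm) nalgebra_scheme \<Rightarrow>
    (('b \<Rightarrow> 'k) \<Rightarrow> 'k) \<Rightarrow> ('b \<Rightarrow> 'k) \<Rightarrow> ('b \<Rightarrow> 'k)"
  where "arens_act B F f = (\<lambda>b\<in>vcarrier B. F (dual_ract B f b))"

definition arens_mult :: "('k::real_normed_field, 'b, 'm) nalgebra_scheme \<Rightarrow>
    (('b \<Rightarrow> 'k) \<Rightarrow> 'k) \<Rightarrow> (('b \<Rightarrow> 'k) \<Rightarrow> 'k) \<Rightarrow> (('b \<Rightarrow> 'k) \<Rightarrow> 'k)"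
  where "arens_mult B F G = (\<lambda>f\<in>vcarrier (dual B). F (arens_act B G f))"

definition bidual ::
  "('k::real_normed_field, 'b, 'm) nalgebra_scheme \<Rightarrow> ('k, ('b \<Rightarrow> 'k) \<Rightarrow> 'k) nalgebra"
  where "bidual B = nspace.extend (dual (dual B)) (nalgebra.fields (arens_mult B))"

section \<open>Even duals of a Banach algebra\<close>

definition isometric_iso :: "('k::real_normed_field, 'a, 'm) nspace_scheme \<Rightarrow>
    ('k, 'b, 'n) nspace_scheme \<Rightarrow> ('a \<Rightarrow> 'b) \<Rightarrow> bool"
  where "isometric_iso X Y \<phi> \<longleftrightarrow>
    bij_betw \<phi> (vcarrier X) (vcarrier Y) \<and>
    (\<forall>x\<in>vcarrier X. \<forall>y\<in>vcarrier X. \<phi> (vadd X x y) = vadd Y (\<phi> x) (\<phi> y)) \<and>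
    \<phi> (vzero X) = vzero Y \<and>
    (\<forall>c. \<forall>x\<in>vcarrier X. \<phi> (vscale X c x) = vscale Y c (\<phi> x)) \<and>
    (\<forall>x\<in>vcarrier X. vnorm Y (\<phi> x) = vnorm X x)"

definition isometric_algebra_iso :: "('k::real_normed_field, 'a, 'm) nalgebra_scheme \<Rightarrow>
    ('k, 'b, 'n) nalgebra_scheme \<Rightarrow> ('a \<Rightarrow> 'b) \<Rightarrow> bool"
  where "isometric_algebra_iso A B \<phi> \<longleftrightarrow> isometric_iso A B \<phi> \<and>
    (\<forall>x\<in>vcarrier A. \<forall>y\<in>vcarrier A. \<phi> (amult A x y) = amult B (\<phi> x) (\<phi> y))"

text \<open>
  \<open>even_dual A n B\<close> says that \<open>B\<close> is \<open>A\<^sup>(\<^sup>n\<^sup>)\<close> (\<open>n\<close> even) with the iterated first Arens product.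
  All stages of the construction have to live in the one type \<open>'u\<close>, so each stage is only
  required to be an isometrically isomorphic copy of the literal one. This is no restriction:
  by \<open>even_dual_self\<close> and \<open>even_dual_bidual\<close> below, the literal algebras \<open>A\<close>, \<open>bidual A\<close>,
  \<open>bidual (bidual A)\<close> and so on are instances, for \<open>'u\<close> the type of their elements.
\<close>

inductive even_dual :: "('k::real_normed_field, 'a) nalgebra \<Rightarrow> nat \<Rightarrow> ('k, 'u) nalgebra \<Rightarrow> bool"
  for A :: "('k, 'a) nalgebra"
  where
    zero: "isometric_algebra_iso A B \<phi> \<Longrightarrow> even_dual A 0 B"
  | step: "\<lbrakk>even_dual A n B; isometric_algebra_iso (bidual B) C \<phi>\<rbrakk> \<Longrightarrow> even_dual A (n + 2) C"

section \<open>Derivations, weak amenability and the weak*-to-weak property\<close>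

definition TS_derivation :: "('k::real_normed_field, 'b, 'm) nalgebra_scheme \<Rightarrow>
    ('k, 'x, 'b, 'n) bimodule_scheme \<Rightarrow> ('b \<Rightarrow> 'b) \<Rightarrow> ('b \<Rightarrow> 'b) \<Rightarrow> ('b \<Rightarrow> 'x) \<Rightarrow> bool"
  where "TS_derivation B X T S D \<longleftrightarrow> bounded_linear_map B X D \<and>
    (\<forall>x\<in>vcarrier B. \<forall>y\<in>vcarrier B.
      D (amult B x y) = vadd X (lact X (T x) (D y)) (ract X (D x) (S y)))"

definition inner_TS_derivation :: "('k::real_normed_field, 'b, 'm) nalgebra_scheme \<Rightarrow>
    ('k, 'x, 'b, 'n) bimodule_scheme \<Rightarrow> ('b \<Rightarrow> 'b) \<Rightarrow> ('b \<Rightarrow> 'b) \<Rightarrow> ('b \<Rightarrow> 'x) \<Rightarrow> bool"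
  where "inner_TS_derivation B X T S D \<longleftrightarrow>
    (\<exists>x\<in>vcarrier X. \<forall>a\<in>vcarrier B. D a = vminus X (lact X (T a) x) (ract X x (S a)))"

definition weakly_TS_amenable ::
  "('k::real_normed_field, 'b, 'm) nalgebra_scheme \<Rightarrow> ('b \<Rightarrow> 'b) \<Rightarrow> ('b \<Rightarrow> 'b) \<Rightarrow> bool"
  where "weakly_TS_amenable B T S \<longleftrightarrow>
    (\<forall>D. TS_derivation B (dual_bimodule B) T S D \<longrightarrow>
         inner_TS_derivation B (dual_bimodule B) T S D)"

definition weak_topology :: "('k::real_normed_field, 'a, 'm) nspace_scheme \<Rightarrow> 'a topology"
  where "weak_topology X = topology_generated_by
    {{x \<in> vcarrier X. f x \<in> U} | f U. f \<in> vcarrier (dual X) \<and> open U}"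

text \<open>The weak* topology of \<open>X\<close> is a topology on the dual of \<open>X\<close>.\<close>

definition weak_star_topology ::
  "('k::real_normed_field, 'a, 'm) nspace_scheme \<Rightarrow> ('a \<Rightarrow> 'k) topology"
  where "weak_star_topology X = topology_generated_by
    {{f \<in> vcarrier (dual X). f x \<in> U} | x U. x \<in> vcarrier X \<and> open U}"

definition wstar_w_elem :: "('k::real_normed_field, 'b, 'm) nalgebra_scheme \<Rightarrow>
    ('b \<Rightarrow> 'b) \<Rightarrow> (('b \<Rightarrow> 'k) \<Rightarrow> 'k) \<Rightarrow> bool"
  where "wstar_w_elem B T F \<longleftrightarrow>
    continuous_map (weak_star_topology (dual B)) (weak_topology (bidual B))
      (\<lambda>G. amult (bidual B) F (second_adjoint B B T G))"

definition wstar_w_property :: "('k::real_normed_field, 'b, 'm) nalgebra_scheme \<Rightarrow>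
    ('b \<Rightarrow> 'b) \<Rightarrow> (('b \<Rightarrow> 'k) \<Rightarrow> 'k) set \<Rightarrow> bool"
  where "wstar_w_property B T M \<longleftrightarrow> (\<forall>F\<in>M. wstar_w_elem B T F)"

section \<open>Every even dual is represented\<close>

lemma bidual_simps [simp]:
  "vcarrier (bidual B) = vcarrier (dual (dual B))" "vadd (bidual B) = vadd (dual (dual B))"
  "vzero (bidual B) = vzero (dual (dual B))" "vscale (bidual B) = vscale (dual (dual B))"
  "vnorm (bidual B) = vnorm (dual (dual B))" "amult (bidual B) = arens_mult B"
  by (simp_all add: bidual_def nspace.defs nalgebra.defs)

lemma mem_dual_iff: "f \<in> vcarrier (dual X) \<longleftrightarrow> f \<in> extensional (vcarrier X) \<and>
    (\<forall>x\<in>vcarrier X. \<forall>y\<in>vcarrier X. f (vadd X x y) = f x + f y) \<and>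
    (\<forall>c. \<forall>x\<in>vcarrier X. f (vscale X c x) = c * f x) \<and>
    (\<exists>K. \<forall>x\<in>vcarrier X. norm (f x) \<le> K * vnorm X x)"
  by (auto simp: dual_def bounded_linear_map_def scalars_def)

lemma dual_add: "\<lbrakk>f \<in> vcarrier (dual X); x \<in> vcarrier X; y \<in> vcarrier X\<rbrakk> \<Longrightarrow> f (vadd X x y) = f x + f y"
  and dual_scale: "\<lbrakk>f \<in> vcarrier (dual X); x \<in> vcarrier X\<rbrakk> \<Longrightarrow> f (vscale X c x) = c * f x"
  and dual_extensional: "f \<in> vcarrier (dual X) \<Longrightarrow> f \<in> extensional (vcarrier X)"
  by (simp_all add: mem_dual_iff)

lemma dual_ops [simp]:
  "vadd (dual X) = (\<lambda>f g. \<lambda>x\<in>vcarrier X. f x + g x)"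
  "vzero (dual X) = (\<lambda>x\<in>vcarrier X. 0)"
  "vscale (dual X) = (\<lambda>c f. \<lambda>x\<in>vcarrier X. c * f x)"
  by (simp_all add: dual_def)

lemma vnorm_dual: "vnorm (dual X) f = (SUP x\<in>{x \<in> vcarrier X. vnorm X x \<le> 1}. norm (f x))"
  by (simp add: dual_def)

context normed_space
begin

lemma norm_zero: "vnorm X (vzero X) = 0"
  using norm_eq_zero zero_closed by blast

lemma unit_ball_nonempty: "{x \<in> vcarrier X. vnorm X x \<le> 1} \<noteq> {}"
  using norm_zero zero_closed by (intro notI) (auto dest: equalityD1)

lemma dual_zero: assumes "f \<in> vcarrier (dual X)" shows "f (vzero X) = 0"
  using dual_add[OF assms zero_closed zero_closed] add_zero[OF zero_closed] by simp

lemma bdd_above_dual: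
  assumes "f \<in> vcarrier (dual X)"
  shows "bdd_above ((\<lambda>x. norm (f x)) ` {x \<in> vcarrier X. vnorm X x \<le> 1})"
proof -
  obtain K where K: "\<And>x. x \<in> vcarrier X \<Longrightarrow> norm (f x) \<le> K * vnorm X x"
    using assms unfolding mem_dual_iff by blast
  have "norm (f x) \<le> \<bar>K\<bar>" if "x \<in> vcarrier X" "vnorm X x \<le> 1" for x
  proof -
    have "norm (f x) \<le> \<bar>K\<bar> * vnorm X x"
      using K[OF that(1)] norm_nonneg[OF that(1)] by (smt (verit) mult_right_mono)
    also have "\<dots> \<le> \<bar>K\<bar> * 1" by (intro mult_left_mono that) auto
    finally show ?thesis by simp
  qed
  then show ?thesis by (intro bdd_aboveI2[of _ _ "\<bar>K\<bar>"]) auto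
qed

lemma norm_dual_upper:
  assumes "f \<in> vcarrier (dual X)" "x \<in> vcarrier X" "vnorm X x \<le> 1"
  shows "norm (f x) \<le> vnorm (dual X) f"
  unfolding vnorm_dual using assms by (intro cSUP_upper bdd_above_dual) auto

lemma norm_dual_nonneg: assumes "f \<in> vcarrier (dual X)" shows "0 \<le> vnorm (dual X) f"
  using norm_dual_upper[OF assms zero_closed] norm_zero by (smt (verit) norm_ge_zero)

lemma dual_bound:
  assumes f: "f \<in> vcarrier (dual X)" and x: "x \<in> vcarrier X"
  shows "norm (f x) \<le> vnorm (dual X) f * vnorm X x"
proof (cases "vnorm X x = 0")
  case True
  then have "f x = 0" using norm_eq_zero[OF x] dual_zero[OF f] by simp
  then show ?thesis using True by simp
next
  case False
  then have pos: "vnorm X x > 0" using norm_nonneg[OF x] by simp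
  define c :: 'k where "c = of_real (1 / vnorm X x)"
  have nc: "norm c = 1 / vnorm X x" using pos by (simp add: c_def norm_divide)
  have "vnorm X (vscale X c x) = 1" using pos by (simp add: norm_scale[OF x] nc)
  then have "norm (f (vscale X c x)) \<le> vnorm (dual X) f"
    by (intro norm_dual_upper f scale_closed x) simp
  then have "norm (f x) / vnorm X x \<le> vnorm (dual X) f"
    by (simp add: dual_scale[OF f x] norm_mult nc)
  then show ?thesis using pos by (simp add: divide_le_eq)
qed

lemma norm_dual_le:
  assumes "0 \<le> K" "\<And>x. x \<in> vcarrier X \<Longrightarrow> norm (f x) \<le> K * vnorm X x"
  shows "vnorm (dual X) f \<le> K"
  unfolding vnorm_dual
proof (intro cSUP_least unit_ball_nonempty)
  fix x assume "x \<in> {x \<in> vcarrier X. vnorm X x \<le> 1}"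
  then have "norm (f x) \<le> K * vnorm X x" "vnorm X x \<le> 1" using assms by auto
  then show "norm (f x) \<le> K" using mult_left_mono[OF \<open>vnorm X x \<le> 1\<close> assms(1)] by simp
qed

lemma dualI:
  assumes "f \<in> extensional (vcarrier X)"
    and "\<And>x y. x \<in> vcarrier X \<Longrightarrow> y \<in> vcarrier X \<Longrightarrow> f (vadd X x y) = f x + f y"
    and "\<And>c x. x \<in> vcarrier X \<Longrightarrow> f (vscale X c x) = c * f x"
    and "\<And>x. x \<in> vcarrier X \<Longrightarrow> norm (f x) \<le> K * vnorm X x"
  shows "f \<in> vcarrier (dual X)"
  using assms unfolding mem_dual_iff by blast

lemma dual_add_bound:
  assumes "f \<in> vcarrier (dual X)" "g \<in> vcarrier (dual X)" "x \<in> vcarrier X"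
  shows "norm (f x + g x) \<le> (vnorm (dual X) f + vnorm (dual X) g) * vnorm X x"
  using dual_bound[OF assms(1,3)] dual_bound[OF assms(2,3)] norm_triangle_ineq[of "f x" "g x"]
  by (simp add: distrib_right)

lemma dual_scale_bound:
  assumes "f \<in> vcarrier (dual X)" "x \<in> vcarrier X"
  shows "norm (c * f x) \<le> (norm c * vnorm (dual X) f) * vnorm X x"
  using mult_left_mono[OF dual_bound[OF assms] norm_ge_zero[of c]] by (simp add: norm_mult mult.assoc)

lemma dual_add_closed:
  assumes "f \<in> vcarrier (dual X)" "g \<in> vcarrier (dual X)"
  shows "vadd (dual X) f g \<in> vcarrier (dual X)"
  using assms dual_add_bound[OF assms]
  by (intro dualI[where K = "vnorm (dual X) f + vnorm (dual X) g"])
     (auto simp: add_closed scale_closed dual_add dual_scale algebra_simps)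

lemma dual_scale_closed:
  assumes "f \<in> vcarrier (dual X)"
  shows "vscale (dual X) c f \<in> vcarrier (dual X)"
  using assms dual_scale_bound[OF assms]
  by (intro dualI[where K = "norm c * vnorm (dual X) f"])
     (auto simp: add_closed scale_closed dual_add dual_scale algebra_simps)

lemma dual_zero_closed: "vzero (dual X) \<in> vcarrier (dual X)"
  by (intro dualI[where K = 0]) (auto simp: add_closed scale_closed)

lemma dual_ext:
  assumes "f \<in> vcarrier (dual X)" "g \<in> vcarrier (dual X)" "\<And>x. x \<in> vcarrier X \<Longrightarrow> f x = g x"
  shows "f = g"
  using assms by (intro extensionalityI[of _ "vcarrier X"]) (auto dest: dual_extensional)

lemma normed_space_dual: "normed_space (dual X)"
proof
  fix f g h :: "'a \<Rightarrow> 'k" and c d :: 'k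
  assume f: "f \<in> vcarrier (dual X)"
  have le: "vnorm (dual X) (vscale (dual X) c f) \<le> norm c * vnorm (dual X) f"
    if "f \<in> vcarrier (dual X)" for c f
    using that dual_scale_bound[OF that] by (intro norm_dual_le) (auto simp: norm_dual_nonneg)
  show "vscale (dual X) c f \<in> vcarrier (dual X)" by (rule dual_scale_closed[OF f])
  show "vadd (dual X) f (vzero (dual X)) = f"
    by (rule dual_ext) (use f dual_add_closed[OF f dual_zero_closed] in auto)
  show "\<exists>k\<in>vcarrier (dual X). vadd (dual X) f k = vzero (dual X)"
    by (rule bexI[OF _ dual_scale_closed[OF f, of "- 1"]]) (auto simp: fun_eq_iff)
  show "vscale (dual X) (c + d) f = vadd (dual X) (vscale (dual X) c f) (vscale (dual X) d f)"
    by (auto simp: fun_eq_iff algebra_simps)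
  show "vscale (dual X) c (vscale (dual X) d f) = vscale (dual X) (c * d) f"
    by (auto simp: fun_eq_iff algebra_simps)
  show one: "vscale (dual X) 1 f = f"
    by (rule dual_ext) (use f dual_scale_closed[OF f, of 1] in auto)
  show "0 \<le> vnorm (dual X) f" by (rule norm_dual_nonneg[OF f])
  show "vnorm (dual X) f = 0 \<longleftrightarrow> f = vzero (dual X)"
  proof
    assume "vnorm (dual X) f = 0"
    then show "f = vzero (dual X)"
      using dual_bound[OF f] by (intro dual_ext[OF f dual_zero_closed]) auto
  next
    assume "f = vzero (dual X)"
    then have "vnorm (dual X) f \<le> 0" by (intro norm_dual_le) auto
    then show "vnorm (dual X) f = 0" using norm_dual_nonneg[OF f] by simp
  qed
  show "vnorm (dual X) (vscale (dual X) c f) = norm c * vnorm (dual X) f"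
  proof (cases "c = 0")
    case True
    then show ?thesis using le[OF f, of c] norm_dual_nonneg[OF dual_scale_closed[OF f, of c]] by simp
  next
    case False
    have "vscale (dual X) (inverse c) (vscale (dual X) c f) = vscale (dual X) 1 f"
      using False by (auto simp: fun_eq_iff)
    then have "vnorm (dual X) f \<le> norm (inverse c) * vnorm (dual X) (vscale (dual X) c f)"
      using le[OF dual_scale_closed[OF f, of c], of "inverse c"] one by simp
    then have "norm c * vnorm (dual X) f
        \<le> norm c * (norm (inverse c) * vnorm (dual X) (vscale (dual X) c f))"
      by (rule mult_left_mono) simp
    also have "\<dots> = vnorm (dual X) (vscale (dual X) c f)"
      using False by (simp add: mult.assoc[symmetric] norm_mult[symmetric] del: dual_ops)
    finally have "norm c * vnorm (dual X) f \<le> vnorm (dual X) (vscale (dual X) c f)" .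
    then show ?thesis using le[OF f, of c] by simp
  qed
  assume g: "g \<in> vcarrier (dual X)"
  show "vadd (dual X) f g \<in> vcarrier (dual X)" by (rule dual_add_closed[OF f g])
  show "vadd (dual X) f g = vadd (dual X) g f" by (auto simp: fun_eq_iff)
  show "vscale (dual X) c (vadd (dual X) f g) = vadd (dual X) (vscale (dual X) c f) (vscale (dual X) c g)"
    by (auto simp: fun_eq_iff algebra_simps)
  show "vnorm (dual X) (vadd (dual X) f g) \<le> vnorm (dual X) f + vnorm (dual X) g"
    using dual_add_bound[OF f g] f g by (intro norm_dual_le) (auto simp: norm_dual_nonneg)
  show "vadd (dual X) (vadd (dual X) f g) h = vadd (dual X) f (vadd (dual X) g h)"
    by (auto simp: fun_eq_iff)
next
  show "vzero (dual X) \<in> vcarrier (dual X)" by (rule dual_zero_closed)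
qed

end

lemma dual_ract_extensional [simp]: "dual_ract B f b \<in> extensional (vcarrier B)"
  unfolding dual_ract_def by (rule restrict_extensional)

context normed_algebra
begin

lemma dual_ract_closed:
  assumes f: "f \<in> vcarrier (dual X)" and b: "b \<in> vcarrier X"
  shows "dual_ract X f b \<in> vcarrier (dual X)"
    and "vnorm (dual X) (dual_ract X f b) \<le> vnorm (dual X) f * vnorm X b"
proof -
  have bd: "norm (dual_ract X f b c) \<le> (vnorm (dual X) f * vnorm X b) * vnorm X c"
    if c: "c \<in> vcarrier X" for c
    using dual_bound[OF f mult_closed[OF b c]]
      mult_left_mono[OF norm_mult_le[OF b c] norm_dual_nonneg[OF f]] c
    by (simp add: dual_ract_def mult.assoc)
  show "dual_ract X f b \<in> vcarrier (dual X)"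
    by (rule dualI[OF dual_ract_extensional _ _ bd])
       (use f b in \<open>auto simp: dual_ract_def mult_add_right mult_scale_right mult_closed add_closed
          scale_closed dual_add dual_scale\<close>)
  show "vnorm (dual X) (dual_ract X f b) \<le> vnorm (dual X) f * vnorm X b"
    by (rule norm_dual_le[OF _ bd]) (auto simp: norm_dual_nonneg f b norm_nonneg)
qed

sublocale D: normed_space "dual X" by (rule normed_space_dual)
sublocale DD: normed_space "dual (dual X)" by (rule D.normed_space_dual)

lemma arens_act_closed:
  assumes F: "F \<in> vcarrier (dual (dual X))" and f: "f \<in> vcarrier (dual X)"
  shows "arens_act X F f \<in> vcarrier (dual X)"
    and "vnorm (dual X) (arens_act X F f) \<le> vnorm (dual (dual X)) F * vnorm (dual X) f"
proof -
  have bd: "norm (arens_act X F f b) \<le> (vnorm (dual (dual X)) F * vnorm (dual X) f) * vnorm X b"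
    if b: "b \<in> vcarrier X" for b
    using D.dual_bound[OF F dual_ract_closed(1)[OF f b]]
      mult_left_mono[OF dual_ract_closed(2)[OF f b] D.norm_dual_nonneg[OF F]] b
    by (simp add: arens_act_def mult.assoc)
  show "arens_act X F f \<in> vcarrier (dual X)"
  proof (rule dualI[OF _ _ _ bd])
    show "arens_act X F f \<in> extensional (vcarrier X)" by (simp add: arens_act_def)
  next
    fix x y assume xy: "x \<in> vcarrier X" "y \<in> vcarrier X"
    have "dual_ract X f (vadd X x y) = vadd (dual X) (dual_ract X f x) (dual_ract X f y)"
      using xy f by (auto simp: dual_ract_def fun_eq_iff mult_add_left mult_closed dual_add)
    then show "arens_act X F f (vadd X x y) = arens_act X F f x + arens_act X F f y"
      using xy dual_add[OF F dual_ract_closed(1)[OF f xy(1)] dual_ract_closed(1)[OF f xy(2)]]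
      by (simp add: arens_act_def add_closed)
  next
    fix c x assume x: "x \<in> vcarrier X"
    have "dual_ract X f (vscale X c x) = vscale (dual X) c (dual_ract X f x)"
      using x f by (auto simp: dual_ract_def fun_eq_iff mult_scale_left mult_closed dual_scale)
    then show "arens_act X F f (vscale X c x) = c * arens_act X F f x"
      using x dual_scale[OF F dual_ract_closed(1)[OF f x]]
      by (simp add: arens_act_def scale_closed)
  qed
  show "vnorm (dual X) (arens_act X F f) \<le> vnorm (dual (dual X)) F * vnorm (dual X) f"
    by (rule norm_dual_le[OF _ bd]) (auto simp: norm_dual_nonneg D.norm_dual_nonneg F f)
qed

lemma dual_ract_add_left:
  assumes "f \<in> vcarrier (dual X)" "g \<in> vcarrier (dual X)" "b \<in> vcarrier X"
  shows "dual_ract X (vadd (dual X) f g) b = vadd (dual X) (dual_ract X f b) (dual_ract X g b)"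
  using assms by (auto simp: dual_ract_def fun_eq_iff mult_closed)

lemma dual_ract_scale_left:
  assumes "f \<in> vcarrier (dual X)" "b \<in> vcarrier X"
  shows "dual_ract X (vscale (dual X) c f) b = vscale (dual X) c (dual_ract X f b)"
  using assms by (auto simp: dual_ract_def fun_eq_iff mult_closed)

lemma arens_act_add_right:
  assumes "F \<in> vcarrier (dual (dual X))" "f \<in> vcarrier (dual X)" "g \<in> vcarrier (dual X)"
  shows "arens_act X F (vadd (dual X) f g) = vadd (dual X) (arens_act X F f) (arens_act X F g)"
  using assms dual_ract_add_left[OF assms(2,3)] dual_add[OF assms(1)] dual_ract_closed(1)
  by (intro ext) (simp add: arens_act_def)

lemma arens_act_scale_right:
  assumes "F \<in> vcarrier (dual (dual X))" "f \<in> vcarrier (dual X)"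
  shows "arens_act X F (vscale (dual X) c f) = vscale (dual X) c (arens_act X F f)"
  using dual_ract_scale_left[OF assms(2), of _ c] dual_scale[OF assms(1), of _ c]
    dual_ract_closed(1)[OF assms(2)]
  by (intro ext) (simp add: arens_act_def)

lemma arens_mult_closed:
  assumes F: "F \<in> vcarrier (dual (dual X))" and G: "G \<in> vcarrier (dual (dual X))"
  shows "arens_mult X F G \<in> vcarrier (dual (dual X))"
    and "vnorm (dual (dual X)) (arens_mult X F G) \<le> vnorm (dual (dual X)) F * vnorm (dual (dual X)) G"
proof -
  have bd: "norm (arens_mult X F G f) \<le> (vnorm (dual (dual X)) F * vnorm (dual (dual X)) G) * vnorm (dual X) f"
    if f: "f \<in> vcarrier (dual X)" for f
    using D.dual_bound[OF F arens_act_closed(1)[OF G f]]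
      mult_left_mono[OF arens_act_closed(2)[OF G f] D.norm_dual_nonneg[OF F]] f
    by (simp add: arens_mult_def mult.assoc)
  show "arens_mult X F G \<in> vcarrier (dual (dual X))"
  proof (rule D.dualI[OF _ _ _ bd])
    fix f g assume fg: "f \<in> vcarrier (dual X)" "g \<in> vcarrier (dual X)"
    show "arens_mult X F G (vadd (dual X) f g) = arens_mult X F G f + arens_mult X F G g"
      using fg dual_add_closed[OF fg] arens_act_add_right[OF G fg]
        dual_add[OF F arens_act_closed(1)[OF G fg(1)] arens_act_closed(1)[OF G fg(2)]]
      by (simp add: arens_mult_def del: dual_ops)
  next
    fix c f assume f: "f \<in> vcarrier (dual X)"
    show "arens_mult X F G (vscale (dual X) c f) = c * arens_mult X F G f"
      using f dual_scale_closed[OF f] arens_act_scale_right[OF G f]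
        dual_scale[OF F arens_act_closed(1)[OF G f]]
      by (simp add: arens_mult_def del: dual_ops)
  qed (unfold arens_mult_def, rule restrict_extensional)
  show "vnorm (dual (dual X)) (arens_mult X F G) \<le> vnorm (dual (dual X)) F * vnorm (dual (dual X)) G"
    by (rule D.norm_dual_le[OF _ bd]) (auto simp: D.norm_dual_nonneg F G)
qed

lemma arens_mult_apply: "f \<in> vcarrier (dual X) \<Longrightarrow> arens_mult X F G f = F (arens_act X G f)"
  by (simp add: arens_mult_def)

lemma arens_act_mult:
  assumes F: "F \<in> vcarrier (dual (dual X))" and G: "G \<in> vcarrier (dual (dual X))"
    and f: "f \<in> vcarrier (dual X)"
  shows "arens_act X (arens_mult X F G) f = arens_act X F (arens_act X G f)"
proof -
  have "arens_act X G (dual_ract X f b) = dual_ract X (arens_act X G f) b" if b: "b \<in> vcarrier X" for b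
  proof -
    have "dual_ract X (dual_ract X f b) c = dual_ract X f (amult X b c)" if "c \<in> vcarrier X" for c
      using b that by (auto simp: dual_ract_def fun_eq_iff mult_closed mult_assoc)
    then show ?thesis using b by (intro ext) (simp add: arens_act_def dual_ract_def[of X "restrict _ _"] mult_closed)
  qed
  then show ?thesis
    using dual_ract_closed(1)[OF f] arens_act_closed(1)[OF G f] f
    by (intro ext) (simp add: arens_act_def[of X F] arens_act_def[of X "arens_mult X F G"]
      arens_mult_apply)
qed

lemma normed_algebra_bidual: "normed_algebra (bidual X)"
proof -
  interpret B: normed_space "bidual X"
    by unfold_locales (unfold bidual_simps, (fact DD.add_closed DD.zero_closed DD.scale_closed
      DD.add_assoc DD.add_commute DD.add_zero DD.add_inverse DD.scale_add_right DD.scale_add_left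
      DD.scale_scale DD.scale_one DD.norm_nonneg DD.norm_eq_zero DD.norm_scale DD.norm_triangle)+)
  show ?thesis
  proof
    fix F G H c
    assume "F \<in> vcarrier (bidual X)" "G \<in> vcarrier (bidual X)"
    then have F: "F \<in> vcarrier (dual (dual X))" and G: "G \<in> vcarrier (dual (dual X))" by simp_all
    show "amult (bidual X) F G \<in> vcarrier (bidual X)" using arens_mult_closed(1)[OF F G] by simp
    show "vnorm (bidual X) (amult (bidual X) F G) \<le> vnorm (bidual X) F * vnorm (bidual X) G"
      using arens_mult_closed(2)[OF F G] by simp
    show "amult (bidual X) (vscale (bidual X) c F) G = vscale (bidual X) c (amult (bidual X) F G)"
      using arens_act_closed(1)[OF G] by (auto simp: arens_mult_def fun_eq_iff)
    have "arens_act X (vscale (dual (dual X)) c G) f = vscale (dual X) c (arens_act X G f)"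
      if "f \<in> vcarrier (dual X)" for f
      using dual_ract_closed(1)[OF that] by (auto simp: arens_act_def fun_eq_iff)
    then show "amult (bidual X) F (vscale (bidual X) c G) = vscale (bidual X) c (amult (bidual X) F G)"
      using dual_scale[OF F arens_act_closed(1)[OF G], of _ c]
      by (intro ext) (simp add: arens_mult_def)
    assume "H \<in> vcarrier (bidual X)"
    then have H: "H \<in> vcarrier (dual (dual X))" by simp
    show "amult (bidual X) (amult (bidual X) F G) H = amult (bidual X) F (amult (bidual X) G H)"
      using arens_act_mult[OF G H] arens_act_closed(1)[OF H]
      by (intro ext) (simp add: arens_mult_def)
    show "amult (bidual X) (vadd (bidual X) F G) H = vadd (bidual X) (amult (bidual X) F H) (amult (bidual X) G H)"
      using arens_act_closed(1)[OF H] by (auto simp: arens_mult_def fun_eq_iff)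
    have "arens_act X (vadd (dual (dual X)) G H) f = vadd (dual X) (arens_act X G f) (arens_act X H f)"
      if "f \<in> vcarrier (dual X)" for f
      using dual_ract_closed(1)[OF that] by (auto simp: arens_act_def fun_eq_iff)
    then show "amult (bidual X) F (vadd (bidual X) G H) = vadd (bidual X) (amult (bidual X) F G) (amult (bidual X) F H)"
      using dual_add[OF F arens_act_closed(1)[OF G] arens_act_closed(1)[OF H]]
      by (intro ext) (simp add: arens_mult_def)
  qed
qed

end

lemma isometric_iso_D:
  assumes "isometric_iso X Y \<phi>"
  shows "bij_betw \<phi> (vcarrier X) (vcarrier Y)"
    and "x \<in> vcarrier X \<Longrightarrow> \<phi> x \<in> vcarrier Y"
    and "\<lbrakk>x \<in> vcarrier X; y \<in> vcarrier X\<rbrakk> \<Longrightarrow> vadd Y (\<phi> x) (\<phi> y) = \<phi> (vadd X x y)"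
    and "vzero Y = \<phi> (vzero X)"
    and "x \<in> vcarrier X \<Longrightarrow> vscale Y c (\<phi> x) = \<phi> (vscale X c x)"
    and "x \<in> vcarrier X \<Longrightarrow> vnorm Y (\<phi> x) = vnorm X x"
    and "\<lbrakk>x \<in> vcarrier X; y \<in> vcarrier X\<rbrakk> \<Longrightarrow> \<phi> x = \<phi> y \<longleftrightarrow> x = y"
    and "z \<in> vcarrier Y \<Longrightarrow> \<exists>x\<in>vcarrier X. z = \<phi> x"
  using assms by (auto simp: isometric_iso_def bij_betw_def inj_on_eq_iff)

lemma isometric_algebra_iso_D:
  assumes "isometric_algebra_iso A B \<phi>"
  shows "isometric_iso A B \<phi>"
    and "\<lbrakk>x \<in> vcarrier A; y \<in> vcarrier A\<rbrakk> \<Longrightarrow> amult B (\<phi> x) (\<phi> y) = \<phi> (amult A x y)"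
  using assms by (auto simp: isometric_algebra_iso_def)

lemma isometric_iso_trans:
  assumes "isometric_iso X Y \<phi>" "isometric_iso Y Z \<psi>"
  shows "isometric_iso X Z (\<psi> \<circ> \<phi>)"
proof -
  note D = isometric_iso_D[OF assms(1)]
  have "bij_betw (\<psi> \<circ> \<phi>) (vcarrier X) (vcarrier Z)"
    using assms by (auto simp: isometric_iso_def intro: bij_betw_trans)
  then show ?thesis
    using assms D(2) by (simp add: isometric_iso_def)
qed

lemma isometric_algebra_iso_trans:
  assumes "isometric_algebra_iso A B \<phi>" "isometric_algebra_iso B C \<psi>"
  shows "isometric_algebra_iso A C (\<psi> \<circ> \<phi>)"
  using isometric_iso_trans[of A B \<phi> C \<psi>] assms isometric_iso_D(2)[of A B \<phi>]
  by (simp add: isometric_algebra_iso_def)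

lemma (in normed_space) isometric_iso_inv:
  assumes "isometric_iso X Y \<phi>"
  shows "isometric_iso Y X (inv_into (vcarrier X) \<phi>)"
proof -
  note D = isometric_iso_D[OF assms]
  have inv: "inv_into (vcarrier X) \<phi> (\<phi> x) = x" if "x \<in> vcarrier X" for x
    using D(1) that by (simp add: bij_betw_def)
  show ?thesis
    unfolding isometric_iso_def
    using bij_betw_inv_into[OF D(1)]
    by (auto dest!: D(8) simp: D(3-6) inv add_closed scale_closed zero_closed)
qed

lemma (in normed_algebra) isometric_algebra_iso_inv:
  assumes "isometric_algebra_iso X B \<phi>"
  shows "isometric_algebra_iso B X (inv_into (vcarrier X) \<phi>)"
proof -
  note D = isometric_iso_D[OF isometric_algebra_iso_D(1)[OF assms]]
  have inv: "inv_into (vcarrier X) \<phi> (\<phi> x) = x" if "x \<in> vcarrier X" for x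
    using D(1) that by (simp add: bij_betw_def)
  show ?thesis
    unfolding isometric_algebra_iso_def
    using isometric_iso_inv[OF isometric_algebra_iso_D(1)[OF assms]]
    by (auto dest!: D(8) simp: isometric_algebra_iso_D(2)[OF assms] inv mult_closed)
qed

lemma (in normed_algebra) normed_algebra_iso:
  assumes "isometric_algebra_iso X B \<phi>"
  shows "normed_algebra B"
proof -
  note D = isometric_iso_D[OF isometric_algebra_iso_D(1)[OF assms]]
  note D' = D(2-7) isometric_algebra_iso_D(2)[OF assms]
  note cl = add_closed scale_closed mult_closed zero_closed
  show ?thesis
  proof
    fix x assume "x \<in> vcarrier B"
    then show "\<exists>y\<in>vcarrier B. vadd B x y = vzero B"
      using add_inverse D(2,3,4) by (metis D(8))
  qed (auto dest!: D(8) simp: D' cl add_assoc add_zero scale_add_right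
         scale_add_left scale_scale scale_one norm_nonneg norm_eq_zero norm_scale norm_triangle
         mult_assoc mult_add_left mult_add_right mult_scale_left mult_scale_right norm_mult_le
         intro: add_commute)
qed

lemma isometric_iso_dual:
  assumes "normed_space X" "normed_space Y" and iso: "isometric_iso X Y \<phi>"
  shows "isometric_iso (dual Y) (dual X) (\<lambda>f. \<lambda>x\<in>vcarrier X. f (\<phi> x))"
proof -
  interpret X: normed_space X by fact
  interpret Y: normed_space Y by fact
  note D = isometric_iso_D[OF iso]
  define \<psi> where "\<psi> = inv_into (vcarrier X) \<phi>"
  note E = isometric_iso_D[OF X.isometric_iso_inv[OF iso], folded \<psi>_def]
  have \<phi>\<psi>: "\<phi> (\<psi> y) = y" if "y \<in> vcarrier Y" for y
    using D(1) that unfolding \<psi>_def by (metis bij_betw_inv_into_right)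
  have \<psi>\<phi>: "\<psi> (\<phi> x) = x" if "x \<in> vcarrier X" for x
    using D(1) that unfolding \<psi>_def by (metis bij_betw_inv_into_left)
  have 1: "(\<lambda>x\<in>vcarrier X. f (\<phi> x)) \<in> vcarrier (dual X)" if f: "f \<in> vcarrier (dual Y)" for f
  proof (rule X.dualI[where K = "vnorm (dual Y) f"])
    fix x assume x: "x \<in> vcarrier X"
    show "norm ((\<lambda>x\<in>vcarrier X. f (\<phi> x)) x) \<le> vnorm (dual Y) f * vnorm X x"
      using Y.dual_bound[OF f D(2)[OF x]] x by (simp add: D(6))
  qed (use f in \<open>auto simp: D(2) D(3,5)[symmetric] dual_add dual_scale X.add_closed X.scale_closed\<close>)
  have 2: "(\<lambda>y\<in>vcarrier Y. f (\<psi> y)) \<in> vcarrier (dual Y)" if f: "f \<in> vcarrier (dual X)" for f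
  proof (rule Y.dualI[where K = "vnorm (dual X) f"])
    fix y assume y: "y \<in> vcarrier Y"
    show "norm ((\<lambda>y\<in>vcarrier Y. f (\<psi> y)) y) \<le> vnorm (dual X) f * vnorm Y y"
      using X.dual_bound[OF f E(2)[OF y]] y by (simp add: E(6))
  qed (use f in \<open>auto simp: E(2) E(3,5)[symmetric] dual_add dual_scale Y.add_closed Y.scale_closed\<close>)
  have bij: "bij_betw (\<lambda>f. \<lambda>x\<in>vcarrier X. f (\<phi> x)) (vcarrier (dual Y)) (vcarrier (dual X))"
  proof (rule bij_betw_byWitness[where f' = "\<lambda>f. \<lambda>y\<in>vcarrier Y. f (\<psi> y)"])
    show "\<forall>f\<in>vcarrier (dual Y). (\<lambda>y\<in>vcarrier Y. (\<lambda>x\<in>vcarrier X. f (\<phi> x)) (\<psi> y)) = f"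
      using Y.dual_ext[OF 2[OF 1]] by (simp add: \<phi>\<psi> E(2))
    show "\<forall>f\<in>vcarrier (dual X). (\<lambda>x\<in>vcarrier X. (\<lambda>y\<in>vcarrier Y. f (\<psi> y)) (\<phi> x)) = f"
      using X.dual_ext[OF 1[OF 2]] by (simp add: \<psi>\<phi> D(2))
  qed (use 1 2 in blast)+
  have "vnorm (dual X) (\<lambda>x\<in>vcarrier X. f (\<phi> x)) = vnorm (dual Y) f" if f: "f \<in> vcarrier (dual Y)" for f
  proof (rule antisym)
    show "vnorm (dual X) (\<lambda>x\<in>vcarrier X. f (\<phi> x)) \<le> vnorm (dual Y) f"
      by (rule X.norm_dual_le) (use Y.dual_bound[OF f D(2)] f in \<open>auto simp: D(6) Y.norm_dual_nonneg\<close>)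
    show "vnorm (dual Y) f \<le> vnorm (dual X) (\<lambda>x\<in>vcarrier X. f (\<phi> x))"
    proof (rule Y.norm_dual_le)
      fix y assume y: "y \<in> vcarrier Y"
      show "norm (f y) \<le> vnorm (dual X) (\<lambda>x\<in>vcarrier X. f (\<phi> x)) * vnorm Y y"
        using X.dual_bound[OF 1[OF f] E(2)[OF y]] y by (simp add: E(6) E(2) \<phi>\<psi>)
    qed (rule X.norm_dual_nonneg[OF 1[OF f]])
  qed
  then show ?thesis
    using bij unfolding isometric_iso_def
    by (auto simp: fun_eq_iff D(2) X.zero_closed)
qed

lemma isometric_algebra_iso_bidual:
  fixes A :: "('k::real_normed_field, 'a, 'm) nalgebra_scheme"
    and B :: "('k, 'b, 'n) nalgebra_scheme"
  assumes "normed_algebra A" and iso: "isometric_algebra_iso A B \<phi>"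
  shows "\<exists>\<psi>. isometric_algebra_iso (bidual A) (bidual B) \<psi>"
proof -
  interpret A: normed_algebra A by fact
  interpret B: normed_algebra B by (rule A.normed_algebra_iso[OF iso])
  note D = isometric_iso_D[OF isometric_algebra_iso_D(1)[OF iso]] isometric_algebra_iso_D(2)[OF iso]
  define J where "J f = (\<lambda>x\<in>vcarrier A. f (\<phi> x))" for f :: "'b \<Rightarrow> 'k"
  define JJ where "JJ F = (\<lambda>f\<in>vcarrier (dual B). F (J f))" for F :: "('a \<Rightarrow> 'k) \<Rightarrow> 'k"
  have J: "isometric_iso (dual B) (dual A) J"
    using isometric_iso_dual[OF A.normed_space_axioms B.normed_space_axioms isometric_algebra_iso_D(1)[OF iso]]
    by (simp add: J_def[abs_def])
  have JJ: "isometric_iso (dual (dual A)) (dual (dual B)) JJ"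
    using isometric_iso_dual[OF B.D.normed_space_axioms A.D.normed_space_axioms J]
    by (simp add: JJ_def[abs_def])
  have "JJ (arens_mult A F G) = arens_mult B (JJ F) (JJ G)"
    if F: "F \<in> vcarrier (dual (dual A))" and G: "G \<in> vcarrier (dual (dual A))" for F G
  proof -
    have ract: "J (dual_ract B f (\<phi> x)) = dual_ract A (J f) x" if "x \<in> vcarrier A" for f x
      using that by (intro ext) (simp add: J_def dual_ract_def D(2,9) A.mult_closed)
    have "J (arens_act B (JJ G) f) = arens_act A G (J f)" if f: "f \<in> vcarrier (dual B)" for f
      using ract B.dual_ract_closed(1)[OF f D(2)]
      by (intro ext) (simp add: J_def[of "arens_act B _ _"], simp add: arens_act_def JJ_def D(2))
    then show ?thesis
      using B.arens_act_closed(1)[OF isometric_iso_D(2)[OF JJ G]] isometric_iso_D(2)[OF J]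
      by (intro ext) (simp add: JJ_def[of F] JJ_def[of "arens_mult A _ _"], simp add: arens_mult_def)
  qed
  then have "isometric_algebra_iso (bidual A) (bidual B) JJ"
    using JJ by (simp add: isometric_algebra_iso_def isometric_iso_def)
  then show ?thesis by (rule exI[where x = JJ])
qed

lemma even_dual_normed_algebra:
  assumes "even_dual A n B" "normed_algebra A"
  shows "normed_algebra B"
  using assms
  by induction (auto intro: normed_algebra.normed_algebra_iso normed_algebra.normed_algebra_bidual)

lemma isometric_algebra_iso_copy:
  fixes j :: "'u \<Rightarrow> 'v" and B :: "('k::real_normed_field, 'u) nalgebra"
  assumes "inj j"
  shows "isometric_algebra_iso B
    \<lparr>vcarrier = j ` vcarrier B, vadd = (\<lambda>x y. j (vadd B (inv j x) (inv j y))), vzero = j (vzero B),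
     vscale = (\<lambda>c x. j (vscale B c (inv j x))), vnorm = (\<lambda>x. vnorm B (inv j x)),
     amult = (\<lambda>x y. j (amult B (inv j x) (inv j y)))\<rparr> j"
  using assms
  by (auto simp: isometric_algebra_iso_def isometric_iso_def bij_betw_def inj_on_def inj_def)

lemma even_dual_copy:
  fixes j :: "'u \<Rightarrow> 'v" and B :: "('k::real_normed_field, 'u) nalgebra"
  assumes "even_dual A n B" "normed_algebra A" "inj j"
  shows "\<exists>C :: ('k, 'v) nalgebra. even_dual A n C \<and> (\<exists>\<phi>. isometric_algebra_iso B C \<phi>)"
  using assms(1)
proof induction
  case (zero B \<phi>)
  then show ?case
    using isometric_algebra_iso_trans[OF _ isometric_algebra_iso_copy[OF \<open>inj j\<close>, of B]]
      isometric_algebra_iso_copy[OF \<open>inj j\<close>, of B] even_dual.zero by blast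
next
  case (step n B C \<phi>)
  then obtain B' :: "('k, 'v) nalgebra" and \<psi>
    where B': "even_dual A n B'" "isometric_algebra_iso B B' \<psi>" by blast
  have B: "normed_algebra B" by (rule even_dual_normed_algebra[OF step.hyps(1) assms(2)])
  obtain \<theta> where \<theta>: "isometric_algebra_iso (bidual B') (bidual B) \<theta>"
    using isometric_algebra_iso_bidual[OF normed_algebra.normed_algebra_iso[OF B B'(2)]
      normed_algebra.isometric_algebra_iso_inv[OF B B'(2)]] by blast
  show ?case
    using even_dual.step[OF B'(1) isometric_algebra_iso_trans[OF
      isometric_algebra_iso_trans[OF \<theta> step.hyps(2)] isometric_algebra_iso_copy[OF \<open>inj j\<close>, of C]]]
      isometric_algebra_iso_copy[OF \<open>inj j\<close>, of C] by blast
qed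

theorem even_dual_self: "even_dual A 0 A"
  by (rule even_dual.zero[of _ _ id]) (simp add: isometric_algebra_iso_def isometric_iso_def)

theorem even_dual_bidual:
  fixes B :: "('k::real_normed_field, 'u) nalgebra"
  assumes "even_dual A n B" "normed_algebra A"
  shows "even_dual A (n + 2) (bidual B)"
proof -
  have "inj (\<lambda>(x :: 'u) (f :: 'u \<Rightarrow> 'k). f x)"
  proof (rule injI)
    fix x y :: 'u assume "(\<lambda>f :: 'u \<Rightarrow> 'k. f x) = (\<lambda>f. f y)"
    from fun_cong[OF this, of "\<lambda>z. if z = x then 1 else 0"] show "x = y" by (simp split: if_splits)
  qed
  then obtain C :: "('k, ('u \<Rightarrow> 'k) \<Rightarrow> 'k) nalgebra" and \<phi>
    where C: "even_dual A n C" "isometric_algebra_iso B C \<phi>"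
    using even_dual_copy[OF assms] by blast
  have B: "normed_algebra B" by (rule even_dual_normed_algebra[OF assms])
  obtain \<theta> where "isometric_algebra_iso (bidual C) (bidual B) \<theta>"
    using isometric_algebra_iso_bidual[OF normed_algebra.normed_algebra_iso[OF B C(2)]
      normed_algebra.isometric_algebra_iso_inv[OF B C(2)]] by blast
  then show ?thesis by (rule even_dual.step[OF C(1)])
qed

end

theory Submission
  imports Defs
begin

text \<open>
  A \<open>T\<close>-\<open>S\<close>-derivation \<open>D : B \<rightarrow> B*\<close> is extended to its second adjoint
  \<open>D'' : B** \<rightarrow> B***\<close>. Once \<open>D''\<close> is known to be a \<open>T''\<close>-\<open>S''\<close>-derivation
  (\<open>second_adjoint_derivation\<close>), it is inner by assumption, implemented by some
  \<open>\<Phi> \<in> B***\<close>; the restriction of \<open>\<Phi>\<close> to \<open>B\<close> then implements \<open>D\<close>, because second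
  adjoints extend the original maps and the Arens product extends the product of \<open>B\<close>
  (\<open>inner_restrict\<close>).

  For the derivation identity, let \<open>D' : B** \<rightarrow> B*\<close> be the adjoint, \<open>D' H b = H (D b)\<close>, so that
  \<open>D'' F H = F (D' H)\<close>, and write the Arens product with a dot. Unfolding \<open>(F \<cdot> G) (D' H)\<close> by the
  Leibniz rule of \<open>D\<close> gives \<open>F\<close> applied to the functional
  \<open>b \<mapsto> D'' G (H \<cdot> T b) + D' (S'' G \<cdot> H) b\<close> on \<open>B\<close>. The second summand contributes
  \<open>D'' F (S'' G \<cdot> H)\<close> outright, which is \<open>D'' F \<cdot> S'' G\<close> evaluated at \<open>H\<close>. The first
  one has to contribute \<open>D'' G (H \<cdot> T'' F)\<close>, which is \<open>T'' F \<cdot> D'' G\<close> evaluated at \<open>H\<close>. This is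
  an interchange of limits that can fail: it says that the functional
  \<open>F \<mapsto> D'' G (H \<cdot> T'' F)\<close> on \<open>B**\<close> is evaluation at an element of \<open>B*\<close>. The \<open>T\<close>-\<open>w*w\<close>
  property makes this functional weak*-continuous, since \<open>D'' G \<in> B***\<close> is weakly continuous,
  and weak*-continuous functionals are evaluations (\<open>weak_star_continuous_imp_evaluation\<close>).
\<close>

section \<open>Weak*-continuous functionals are evaluations\<close>

text \<open>
  A basic weak*-neighbourhood of \<open>0\<close> restricts the values at finitely many points, hence
  contains the whole annihilator of these points. This form
  of the neighbourhood property passes to intersections by uniting the two sets of points.
\<close>
lemma weak_star_open_zero:
  assumes X: "normed_space X" and "openin (weak_star_topology X) U" "vzero (dual X) \<in> U"
  shows "\<exists>I. finite I \<and> I \<subseteq> vcarrier X \<and>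
    (\<forall>F\<in>vcarrier (dual X). (\<forall>x\<in>I. F x = 0) \<longrightarrow> F \<in> U)"
proof -
  let ?S = "{{f \<in> vcarrier (dual X). f x \<in> U} | x U. x \<in> vcarrier X \<and> open U}"
  have "generate_topology_on ?S U"
    using assms(2) by (simp add: weak_star_topology_def openin_topology_generated_by_iff)
  then show ?thesis
    using assms(3)
  proof (induction U)
    case (Int U V)
    then obtain I J where
      "finite I" "I \<subseteq> vcarrier X" "\<forall>F\<in>vcarrier (dual X). (\<forall>x\<in>I. F x = 0) \<longrightarrow> F \<in> U"
      "finite J" "J \<subseteq> vcarrier X" "\<forall>F\<in>vcarrier (dual X). (\<forall>x\<in>J. F x = 0) \<longrightarrow> F \<in> V"
      by blast
    then show ?case by (intro exI[of _ "I \<union> J"]) auto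
  next
    case (UN K)
    then show ?case by (meson UnionE UnionI)
  next
    case (Basis s)
    then obtain x W where "x \<in> vcarrier X" "s = {f \<in> vcarrier (dual X). f x \<in> W}" by blast
    then show ?case using Basis by (intro exI[of _ "{x}"]) auto
  qed simp
qed

lemma topspace_weak_star:
  assumes "normed_space X"
  shows "topspace (weak_star_topology X) = vcarrier (dual X)"
proof -
  have "vzero X \<in> vcarrier X" by (rule normed_space.zero_closed[OF assms])
  then show ?thesis
    unfolding weak_star_topology_def topology_generated_by_topspace by blast
qed

text \<open>
  The algebraic fact that a functional whose kernel contains the common kernel of finitely many
  evaluations is a combination of them. The combination is again an evaluation, so that the
  induction needs no sums: if some \<open>E\<close> annihilates \<open>I\<close> but not the new point \<open>y\<close>,
  subtracting a multiple of evaluation at \<open>y\<close> makes \<open>L\<close> vanish at \<open>E\<close>, and then on the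
  whole annihilator of \<open>I\<close>.
\<close>
lemma functional_vanishing_on_annihilator:
  fixes X :: "('k::real_normed_field, 'a, 'm) nspace_scheme"
  assumes X: "normed_space X" and "finite I" "I \<subseteq> vcarrier X"
    and "\<And>F G. F \<in> vcarrier (dual X) \<Longrightarrow> G \<in> vcarrier (dual X) \<Longrightarrow> L (vadd (dual X) F G) = L F + L G"
    and "\<And>c F. F \<in> vcarrier (dual X) \<Longrightarrow> L (vscale (dual X) c F) = c * L F"
    and "\<And>F. F \<in> vcarrier (dual X) \<Longrightarrow> \<forall>x\<in>I. F x = 0 \<Longrightarrow> L F = (0::'k)"
  shows "\<exists>x\<in>vcarrier X. \<forall>F\<in>vcarrier (dual X). L F = F x"
  using assms(2-)
proof (induction I arbitrary: L rule: finite_induct)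
  case empty
  then show ?case
    using normed_space.dual_zero[OF X] normed_space.zero_closed[OF X] by fastforce
next
  case (insert y I)
  interpret X: normed_space X by (rule X)
  have y: "y \<in> vcarrier X" and I: "I \<subseteq> vcarrier X" using insert.prems(1) by auto
  show ?case
  proof (cases "\<exists>E\<in>vcarrier (dual X). (\<forall>x\<in>I. E x = 0) \<and> E y \<noteq> 0")
    case False
    then show ?thesis by (intro insert.IH[OF I insert.prems(2,3)]) (auto intro: insert.prems(4))
  next
    case True
    then obtain E where E: "E \<in> vcarrier (dual X)" "\<forall>x\<in>I. E x = 0" "E y \<noteq> 0" by blast
    define c where "c = L E / E y"
    have "\<exists>x\<in>vcarrier X. \<forall>F\<in>vcarrier (dual X). L F - c * F y = F x"
    proof (rule insert.IH[OF I])
      fix F assume F: "F \<in> vcarrier (dual X)" "\<forall>x\<in>I. F x = 0"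
      \<comment> \<open>adding this multiple of \<open>E\<close> corrects \<open>F\<close> to vanish at \<open>y\<close> as well\<close>
      let ?G = "vscale (dual X) (- (F y / E y)) E"
      have G: "?G \<in> vcarrier (dual X)" by (rule X.dual_scale_closed[OF E(1)])
      have "L (vadd (dual X) F ?G) = 0"
        using F E y I by (intro insert.prems(4) X.dual_add_closed F(1) G) auto
      then have "L F + - (F y / E y) * L E = 0"
        by (simp only: insert.prems(2)[OF F(1) G] insert.prems(3)[OF E(1)])
      then show "L F - c * F y = 0" by (simp add: c_def)
    next
      fix F G assume "F \<in> vcarrier (dual X)" "G \<in> vcarrier (dual X)"
      then show "L (vadd (dual X) F G) - c * vadd (dual X) F G y = (L F - c * F y) + (L G - c * G y)"
        using y by (simp add: insert.prems(2) algebra_simps del: dual_ops)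
          (simp add: algebra_simps)
    next
      fix d F assume "F \<in> vcarrier (dual X)"
      then show "L (vscale (dual X) d F) - c * vscale (dual X) d F y = d * (L F - c * F y)"
        using y by (simp add: insert.prems(3) algebra_simps del: dual_ops) simp
    qed
    then obtain x where x: "x \<in> vcarrier X" "\<And>F. F \<in> vcarrier (dual X) \<Longrightarrow> L F - c * F y = F x"
      by blast
    have "L F = F (vadd X x (vscale X c y))" if "F \<in> vcarrier (dual X)" for F
      using x(2)[OF that] dual_add[OF that x(1) X.scale_closed[OF y]] dual_scale[OF that y]
      by (simp add: algebra_simps)
    then show ?thesis using X.add_closed[OF x(1) X.scale_closed[OF y]] by blast
  qed
qed

text \<open>
  By continuity \<open>L\<close> is bounded by \<open>1\<close> on the annihilator of some finite set of points; this
  annihilator being a subspace, \<open>L\<close> vanishes on it.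
\<close>
lemma weak_star_continuous_imp_evaluation:
  fixes X :: "('k::real_normed_field, 'a, 'm) nspace_scheme"
  assumes X: "normed_space X"
    and add: "\<And>F G. F \<in> vcarrier (dual X) \<Longrightarrow> G \<in> vcarrier (dual X) \<Longrightarrow> L (vadd (dual X) F G) = L F + L G"
    and scale: "\<And>c F. F \<in> vcarrier (dual X) \<Longrightarrow> L (vscale (dual X) c F) = c * L F"
    and cont: "continuous_map (weak_star_topology X) euclidean L"
  shows "\<exists>x\<in>vcarrier X. \<forall>F\<in>vcarrier (dual X). L F = (F x :: 'k)"
proof -
  interpret X: normed_space X by (rule X)
  have "L (vzero (dual X)) = L (vscale (dual X) 0 (vzero (dual X)))"
    by (rule arg_cong[where f = L]) (simp add: fun_eq_iff)
  then have L0: "L (vzero (dual X)) = 0" by (simp only: scale[OF X.dual_zero_closed] mult_zero_left)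
  let ?U = "{F \<in> topspace (weak_star_topology X). L F \<in> ball 0 1}"
  have "openin (weak_star_topology X) ?U"
    using cont by (rule openin_continuous_map_preimage) simp
  moreover have "vzero (dual X) \<in> ?U"
    using X.dual_zero_closed L0 by (simp add: topspace_weak_star[OF X])
  ultimately obtain I where I: "finite I" "I \<subseteq> vcarrier X"
      "\<And>F. F \<in> vcarrier (dual X) \<Longrightarrow> \<forall>x\<in>I. F x = 0 \<Longrightarrow> norm (L F) < 1"
    using weak_star_open_zero[OF X, of ?U] by fastforce
  show ?thesis
  proof (rule functional_vanishing_on_annihilator[OF X I(1,2) add scale])
    fix F assume F: "F \<in> vcarrier (dual X)" "\<forall>x\<in>I. F x = 0"
    show "L F = 0"
    proof (rule ccontr)
      assume nz: "L F \<noteq> 0"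
      have "norm (L (vscale (dual X) (inverse (L F)) F)) < 1"
        using F I(2) by (intro I(3) X.dual_scale_closed F(1)) auto
      then show False using nz by (simp only: scale[OF F(1)]) simp
    qed
  qed
qed

section \<open>Adjoints and the canonical embedding\<close>

lemma bounded_linear_map_D:
  assumes "bounded_linear_map X Y T"
  shows "x \<in> vcarrier X \<Longrightarrow> T x \<in> vcarrier Y"
    and "x \<in> vcarrier X \<Longrightarrow> y \<in> vcarrier X \<Longrightarrow> T (vadd X x y) = vadd Y (T x) (T y)"
    and "x \<in> vcarrier X \<Longrightarrow> T (vscale X c x) = vscale Y c (T x)"
  using assms by (auto simp: bounded_linear_map_def)

lemma adjoint_apply:
  "g \<in> vcarrier (dual Y) \<Longrightarrow> x \<in> vcarrier X \<Longrightarrow> adjoint X Y T g x = g (T x)"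
  by (simp add: adjoint_def)

lemma bounded_linear_map_adjoint:
  assumes X: "normed_space X" and Y: "normed_space Y" and T: "bounded_linear_map X Y T"
  shows "bounded_linear_map (dual Y) (dual X) (adjoint X Y T)"
proof -
  interpret X: normed_space X by (rule X)
  interpret Y: normed_space Y by (rule Y)
  note D = bounded_linear_map_D[OF T]
  obtain K where K: "\<And>x. x \<in> vcarrier X \<Longrightarrow> vnorm Y (T x) \<le> K * vnorm X x"
    using T unfolding bounded_linear_map_def by blast
  have bd: "norm (adjoint X Y T g x) \<le> (\<bar>K\<bar> * vnorm (dual Y) g) * vnorm X x"
    if g: "g \<in> vcarrier (dual Y)" and x: "x \<in> vcarrier X" for g x
  proof -
    have "vnorm Y (T x) \<le> \<bar>K\<bar> * vnorm X x"
      using K[OF x] mult_right_mono[OF abs_ge_self[of K] X.norm_nonneg[OF x]] by simp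
    then have "vnorm (dual Y) g * vnorm Y (T x) \<le> vnorm (dual Y) g * (\<bar>K\<bar> * vnorm X x)"
      by (intro mult_left_mono Y.norm_dual_nonneg g)
    then show ?thesis
      using Y.dual_bound[OF g D(1)[OF x]] by (simp add: adjoint_apply g x mult_ac)
  qed
  have cl: "adjoint X Y T g \<in> vcarrier (dual X)" if g: "g \<in> vcarrier (dual Y)" for g
  proof (rule X.dualI[OF _ _ _ bd[OF g]])
    show "adjoint X Y T g \<in> extensional (vcarrier X)" using g by (simp add: adjoint_def)
  qed (auto simp: adjoint_apply g X.add_closed X.scale_closed D dual_add[OF g] dual_scale[OF g])
  show ?thesis
    unfolding bounded_linear_map_def
  proof (intro conjI ballI allI)
    show "adjoint X Y T \<in> vcarrier (dual Y) \<rightarrow> vcarrier (dual X)" using cl by blast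
    show "\<exists>K'. \<forall>g\<in>vcarrier (dual Y). vnorm (dual X) (adjoint X Y T g) \<le> K' * vnorm (dual Y) g"
      by (intro exI[of _ "\<bar>K\<bar>"] ballI X.norm_dual_le bd) (simp_all add: Y.norm_dual_nonneg)
    fix g h assume g: "g \<in> vcarrier (dual Y)" and h: "h \<in> vcarrier (dual Y)"
    show "adjoint X Y T (vadd (dual Y) g h) = vadd (dual X) (adjoint X Y T g) (adjoint X Y T h)"
      using Y.dual_add_closed[OF g h] g h D(1) by (simp add: adjoint_def fun_eq_iff)
  next
    fix c g assume g: "g \<in> vcarrier (dual Y)"
    show "adjoint X Y T (vscale (dual Y) c g) = vscale (dual X) c (adjoint X Y T g)"
      using Y.dual_scale_closed[OF g] g D(1) by (simp add: adjoint_def fun_eq_iff)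
  qed
qed

lemma bounded_linear_map_second_adjoint:
  assumes X: "normed_space X" and Y: "normed_space Y" and T: "bounded_linear_map X Y T"
  shows "bounded_linear_map (dual (dual X)) (dual (dual Y)) (second_adjoint X Y T)"
  unfolding second_adjoint_def
  by (intro bounded_linear_map_adjoint normed_space.normed_space_dual assms)

lemma second_adjoint_apply:
  "F \<in> vcarrier (dual (dual X)) \<Longrightarrow> g \<in> vcarrier (dual Y) \<Longrightarrow>
    second_adjoint X Y T F g = F (adjoint X Y T g)"
  unfolding second_adjoint_def by (rule adjoint_apply)

definition canonical_embedding ::
  "('k::real_normed_field, 'a, 'm) nspace_scheme \<Rightarrow> 'a \<Rightarrow> (('a \<Rightarrow> 'k) \<Rightarrow> 'k)"
  where "canonical_embedding X x = (\<lambda>f\<in>vcarrier (dual X). f x)"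

lemma canonical_embedding_apply [simp]:
  "f \<in> vcarrier (dual X) \<Longrightarrow> canonical_embedding X x f = f x"
  by (simp add: canonical_embedding_def)

lemma bounded_linear_map_canonical_embedding:
  assumes X: "normed_space X"
  shows "bounded_linear_map X (dual (dual X)) (canonical_embedding X)"
proof -
  interpret X: normed_space X by (rule X)
  interpret D: normed_space "dual X" by (rule X.normed_space_dual)
  have bd: "norm (canonical_embedding X x f) \<le> vnorm X x * vnorm (dual X) f"
    if "x \<in> vcarrier X" "f \<in> vcarrier (dual X)" for x f
    using X.dual_bound[OF that(2,1)] that by (simp add: mult.commute)
  have cl: "canonical_embedding X x \<in> vcarrier (dual (dual X))" if x: "x \<in> vcarrier X" for x
  proof (rule D.dualI[OF _ _ _ bd[OF x]])
    show "canonical_embedding X x \<in> extensional (vcarrier (dual X))"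
      by (simp add: canonical_embedding_def)
  next
    fix f g assume "f \<in> vcarrier (dual X)" "g \<in> vcarrier (dual X)"
    then show "canonical_embedding X x (vadd (dual X) f g)
        = canonical_embedding X x f + canonical_embedding X x g"
      using X.dual_add_closed[of f g] x by (simp add: canonical_embedding_def)
  next
    fix c f assume "f \<in> vcarrier (dual X)"
    then show "canonical_embedding X x (vscale (dual X) c f) = c * canonical_embedding X x f"
      using X.dual_scale_closed[of f c] x by (simp add: canonical_embedding_def)
  qed
  have "vnorm (dual (dual X)) (canonical_embedding X x) \<le> 1 * vnorm X x" if "x \<in> vcarrier X" for x
    using bd[OF that] X.norm_nonneg[OF that] by (intro D.norm_dual_le) simp_all
  then show ?thesis
    unfolding bounded_linear_map_def using cl
    by (intro conjI exI[of _ 1]) (auto simp: canonical_embedding_def fun_eq_iff dual_add dual_scale)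
qed

lemma second_adjoint_canonical_embedding:
  assumes X: "normed_space X" and Y: "normed_space Y" and T: "bounded_linear_map X Y T"
    and x: "x \<in> vcarrier X"
  shows "second_adjoint X Y T (canonical_embedding X x) = canonical_embedding Y (T x)"
proof -
  note emb = bounded_linear_map_D(1)[OF bounded_linear_map_canonical_embedding]
  have "second_adjoint X Y T (canonical_embedding X x) g = canonical_embedding Y (T x) g"
    if "g \<in> vcarrier (dual Y)" for g
    using that x bounded_linear_map_D(1)[OF bounded_linear_map_adjoint[OF X Y T]]
    by (simp add: second_adjoint_apply emb[OF X] adjoint_apply)
  then show ?thesis
    by (intro normed_space.dual_ext[OF normed_space.normed_space_dual[OF Y]]
      bounded_linear_map_D(1)[OF bounded_linear_map_second_adjoint[OF X Y T]] emb X Y x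
      bounded_linear_map_D(1)[OF T])
qed

section \<open>Second adjoints of derivations\<close>

lemma dual_bimodule_simps [simp]:
  "vcarrier (dual_bimodule B) = vcarrier (dual B)" "vadd (dual_bimodule B) = vadd (dual B)"
  "vscale (dual_bimodule B) = vscale (dual B)" "vnorm (dual_bimodule B) = vnorm (dual B)"
  "lact (dual_bimodule B) = dual_lact B" "ract (dual_bimodule B) = dual_ract B"
  by (simp_all add: dual_bimodule_def nspace.defs bimodule.defs)

text \<open>
  The two sides are duals of different records, one with the Arens product and one without;
  the dual does not see the multiplication.
\<close>
lemma dual_bidual: "dual (bidual B) = dual (dual (dual B))"
  by (simp add: dual_def[of "bidual B"] dual_def[of "dual (dual B)"] bounded_linear_map_def)

lemma bounded_linear_map_dual_bimodule:
  "bounded_linear_map X (dual_bimodule B) T \<longleftrightarrow> bounded_linear_map X (dual B) T"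
  by (simp add: bounded_linear_map_def)

lemma bounded_linear_map_bidual:
  "bounded_linear_map (bidual B) Y T \<longleftrightarrow> bounded_linear_map (dual (dual B)) Y T"
  by (simp add: bounded_linear_map_def)

context normed_algebra
begin

lemma arens_act_canonical_embedding:
  assumes b: "b \<in> vcarrier X" and f: "f \<in> vcarrier (dual X)"
  shows "arens_act X (canonical_embedding X b) f = dual_lact X b f"
  using dual_ract_closed(1)[OF f] b
  by (intro ext) (simp add: arens_act_def dual_lact_def, simp add: dual_ract_def)

lemma dual_lact_closed:
  assumes b: "b \<in> vcarrier X" and f: "f \<in> vcarrier (dual X)"
  shows "dual_lact X b f \<in> vcarrier (dual X)"
  using arens_act_closed(1)[OF bounded_linear_map_D(1)[OF
      bounded_linear_map_canonical_embedding[OF normed_space_axioms] b] f]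
  by (simp add: arens_act_canonical_embedding[OF b f])

lemma arens_mult_canonical_embedding:
  assumes "b \<in> vcarrier X" "f \<in> vcarrier (dual X)"
  shows "arens_mult X F (canonical_embedding X b) f = F (dual_lact X b f)"
  using assms by (simp add: arens_mult_apply arens_act_canonical_embedding)

lemma canonical_embedding_mult:
  assumes a: "a \<in> vcarrier X" and b: "b \<in> vcarrier X"
  shows "arens_mult X (canonical_embedding X a) (canonical_embedding X b)
    = canonical_embedding X (amult X a b)"
proof -
  note emb = bounded_linear_map_D(1)[OF bounded_linear_map_canonical_embedding[OF normed_space_axioms]]
  show ?thesis
  proof (rule D.dual_ext[OF arens_mult_closed(1)[OF emb[OF a] emb[OF b]] emb[OF mult_closed[OF a b]]])
    fix f assume f: "f \<in> vcarrier (dual X)"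
    then show "arens_mult X (canonical_embedding X a) (canonical_embedding X b) f
        = canonical_embedding X (amult X a b) f"
      using a dual_lact_closed[OF b f] b
      by (simp add: arens_mult_canonical_embedding, simp add: dual_lact_def)
  qed
qed

text \<open>
  The only use of the \<open>T\<close>-\<open>w*w\<close> property: it licenses the replacement of \<open>b \<in> B\<close> by an arbitrary
  \<open>F \<in> B**\<close> in an expression \<open>\<Phi> (H \<cdot> T b)\<close>.
\<close>
lemma wstar_w_functional:
  assumes T: "bounded_linear_map X X T" and H: "H \<in> vcarrier (dual (dual X))"
    and w: "wstar_w_elem X T H" and \<Phi>: "\<Phi> \<in> vcarrier (dual (dual (dual X)))"
  shows "\<exists>f\<in>vcarrier (dual X). \<forall>F\<in>vcarrier (dual (dual X)).
    \<Phi> (arens_mult X H (second_adjoint X X T F)) = F f"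
proof -
  interpret BD: normed_algebra "bidual X" by (rule normed_algebra_bidual)
  note T2 = bounded_linear_map_D[OF bounded_linear_map_second_adjoint[OF normed_space_axioms normed_space_axioms T]]
  have "continuous_map (weak_topology (bidual X)) euclidean \<Phi>"
    unfolding continuous_map_def
  proof (intro conjI allI impI)
    show "\<Phi> \<in> topspace (weak_topology (bidual X)) \<rightarrow> topspace euclidean" by simp
  next
    fix U :: "'k set" assume "openin euclidean U"
    then have "openin (weak_topology (bidual X)) {F \<in> vcarrier (bidual X). \<Phi> F \<in> U}"
      using \<Phi> unfolding weak_topology_def openin_topology_generated_by_iff dual_bidual
      by (intro generate_topology_on.Basis) auto
    moreover have "topspace (weak_topology (bidual X)) = vcarrier (bidual X)"
      using \<Phi> unfolding weak_topology_def topology_generated_by_topspace dual_bidual by blast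
    ultimately show "openin (weak_topology (bidual X)) {F \<in> topspace (weak_topology (bidual X)). \<Phi> F \<in> U}"
      by simp
  qed
  with w have cont: "continuous_map (weak_star_topology (dual X)) euclidean
      (\<lambda>F. \<Phi> (arens_mult X H (second_adjoint X X T F)))"
    unfolding wstar_w_elem_def bidual_simps by (auto dest: continuous_map_compose simp: o_def)
  show ?thesis
  proof (rule weak_star_continuous_imp_evaluation[OF D.normed_space_axioms _ _ cont])
    fix F G assume F: "F \<in> vcarrier (dual (dual X))" and G: "G \<in> vcarrier (dual (dual X))"
    show "\<Phi> (arens_mult X H (second_adjoint X X T (vadd (dual (dual X)) F G)))
      = \<Phi> (arens_mult X H (second_adjoint X X T F)) + \<Phi> (arens_mult X H (second_adjoint X X T G))"
      using BD.mult_add_right[unfolded bidual_simps, OF H T2(1)[OF F] T2(1)[OF G]]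
        dual_add[OF \<Phi> arens_mult_closed(1)[OF H T2(1)[OF F]] arens_mult_closed(1)[OF H T2(1)[OF G]]]
      by (simp only: T2(2)[OF F G])
  next
    fix c F assume F: "F \<in> vcarrier (dual (dual X))"
    show "\<Phi> (arens_mult X H (second_adjoint X X T (vscale (dual (dual X)) c F)))
      = c * \<Phi> (arens_mult X H (second_adjoint X X T F))"
      using BD.mult_scale_right[unfolded bidual_simps, OF H T2(1)[OF F]]
        dual_scale[OF \<Phi> arens_mult_closed(1)[OF H T2(1)[OF F]]]
      by (simp only: T2(3)[OF F])
  qed
qed

text \<open>
  With the first Arens product, \<open>(F \<cdot> G) (D' H) = F (b \<mapsto> G (c \<mapsto> H (D (b \<cdot> c))))\<close>. In the two
  terms \<open>T b \<cdot> D c\<close> and \<open>D b \<cdot> S c\<close> of \<open>D (b \<cdot> c)\<close>, the variable \<open>c\<close> occurs only as an argument of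
  \<open>D\<close> and \<open>S\<close>, so that \<open>G\<close> meets only their adjoints. In the outer functional \<open>F\<close> has to
  reach \<open>T b\<close>, standing to the right of \<open>H\<close>, where the Arens product is not
  weak*-continuous in general; this is where \<open>wstar_w_functional\<close> enters.
\<close>
lemma second_adjoint_derivation:
  assumes T: "bounded_linear_map X X T" and S: "bounded_linear_map X X S"
    and w: "wstar_w_property X T (vcarrier (bidual X))"
    and der: "TS_derivation X (dual_bimodule X) T S D"
  shows "TS_derivation (bidual X) (dual_bimodule (bidual X))
    (second_adjoint X X T) (second_adjoint X X S) (second_adjoint X (dual X) D)"
proof -
  have D: "bounded_linear_map X (dual X) D"
    and leib: "\<And>x y. x \<in> vcarrier X \<Longrightarrow> y \<in> vcarrier X \<Longrightarrow>
      D (amult X x y) = vadd (dual X) (dual_lact X (T x) (D y)) (dual_ract X (D x) (S y))"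
    using der by (simp_all add: TS_derivation_def bounded_linear_map_dual_bimodule)
  note ns = normed_space_axioms D.normed_space_axioms
  note emb = bounded_linear_map_D(1)[OF bounded_linear_map_canonical_embedding[OF ns(1)]]
  let ?T = "second_adjoint X X T" and ?S = "second_adjoint X X S"
    and ?D = "second_adjoint X (dual X) D" and ?D' = "adjoint X (dual X) D"
  note Tcl = bounded_linear_map_D(1)[OF T] and Scl = bounded_linear_map_D(1)[OF S]
    and Dcl = bounded_linear_map_D(1)[OF D]
    and T2 = bounded_linear_map_D(1)[OF bounded_linear_map_second_adjoint[OF ns(1) ns(1) T]]
    and S1 = bounded_linear_map_D(1)[OF bounded_linear_map_adjoint[OF ns(1) ns(1) S]]
    and S2 = bounded_linear_map_D(1)[OF bounded_linear_map_second_adjoint[OF ns(1) ns(1) S]]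
    and D1 = bounded_linear_map_D(1)[OF bounded_linear_map_adjoint[OF ns D]]
    and D2 = bounded_linear_map_D(1)[OF bounded_linear_map_second_adjoint[OF ns D]]
  have eval: "?D (arens_mult X F G) H
      = ?D G (arens_mult X H (?T F)) + ?D F (arens_mult X (?S G) H)"
    if F: "F \<in> vcarrier (dual (dual X))" and G: "G \<in> vcarrier (dual (dual X))"
      and H: "H \<in> vcarrier (dual (dual X))" for F G H
  proof -
    obtain f where f: "f \<in> vcarrier (dual X)"
        "\<And>F. F \<in> vcarrier (dual (dual X)) \<Longrightarrow> ?D G (arens_mult X H (?T F)) = F f"
      using wstar_w_functional[OF T H _ D2[OF G]] w H unfolding wstar_w_property_def bidual_simps
      by blast
    \<comment> \<open>\<open>f\<close> is determined by its values on \<open>B\<close>, where \<open>T''\<close> agrees with \<open>T\<close>\<close>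
    have fb: "f b = ?D G (arens_mult X H (canonical_embedding X (T b)))" if b: "b \<in> vcarrier X" for b
      using f(2)[OF emb[OF b]] f(1) second_adjoint_canonical_embedding[OF ns(1) ns(1) T b] by simp
    let ?K = "arens_mult X (?S G) H"
    have K: "?K \<in> vcarrier (dual (dual X))" by (rule arens_mult_closed(1)[OF S2[OF G] H])
    have "arens_act X G (?D' H) = vadd (dual X) f (?D' ?K)"
    proof (rule dual_ext[OF arens_act_closed(1)[OF G D1[OF H]] dual_add_closed[OF f(1) D1[OF K]]])
      fix b assume b: "b \<in> vcarrier X"
      let ?HT = "arens_mult X H (canonical_embedding X (T b))"
      have HT: "?HT \<in> vcarrier (dual (dual X))" by (rule arens_mult_closed(1)[OF H emb[OF Tcl[OF b]]])
      let ?g = "arens_act X H (D b)"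
      have g: "?g \<in> vcarrier (dual X)" by (rule arens_act_closed(1)[OF H Dcl[OF b]])
      have split: "dual_ract X (?D' H) b = vadd (dual X) (?D' ?HT) (adjoint X X S ?g)"
      proof (rule dual_ext[OF dual_ract_closed(1)[OF D1[OF H] b] dual_add_closed[OF D1[OF HT] S1[OF g]]])
        fix c assume c: "c \<in> vcarrier X"
        have "dual_ract X (?D' H) b c = H (D (amult X b c))"
          using b c by (simp add: dual_ract_def adjoint_apply H mult_closed)
        also have "\<dots> = H (dual_lact X (T b) (D c)) + H (dual_ract X (D b) (S c))"
          unfolding leib[OF b c]
          by (rule dual_add[OF H dual_lact_closed[OF Tcl[OF b] Dcl[OF c]] dual_ract_closed(1)[OF Dcl[OF b] Scl[OF c]]])
        also have "H (dual_lact X (T b) (D c)) = ?D' ?HT c"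
          by (simp add: adjoint_apply HT c arens_mult_canonical_embedding H Tcl b Dcl)
        also have "H (dual_ract X (D b) (S c)) = adjoint X X S ?g c"
          using Scl[OF c] by (simp add: adjoint_apply g c, simp add: arens_act_def)
        finally show "dual_ract X (?D' H) b c = vadd (dual X) (?D' ?HT) (adjoint X X S ?g) c"
          using c by simp
      qed
      have "arens_act X G (?D' H) b = G (?D' ?HT) + G (adjoint X X S ?g)"
        using b dual_add[OF G D1[OF HT] S1[OF g]] by (simp only: arens_act_def restrict_apply' split)
      also have "G (?D' ?HT) = f b" by (simp add: fb b second_adjoint_apply G HT)
      also have "G (adjoint X X S ?g) = ?D' ?K b"
        by (simp add: adjoint_apply K b arens_mult_apply Dcl second_adjoint_apply G g)
      finally show "arens_act X G (?D' H) b = vadd (dual X) f (?D' ?K) b" using b by simp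
    qed
    then have "?D (arens_mult X F G) H = F f + F (?D' ?K)"
      using dual_add[OF F f(1) D1[OF K]]
      by (simp only: second_adjoint_apply[OF arens_mult_closed(1)[OF F G] H]
        arens_mult_apply[OF D1[OF H]])
    then show ?thesis by (simp add: f(2) F second_adjoint_apply K)
  qed
  show ?thesis
    unfolding TS_derivation_def bounded_linear_map_dual_bimodule dual_bidual bounded_linear_map_bidual
      dual_bimodule_simps bidual_simps
  proof (intro conjI ballI bounded_linear_map_second_adjoint ns D)
    fix F G assume F: "F \<in> vcarrier (dual (dual X))" and G: "G \<in> vcarrier (dual (dual X))"
    show "?D (arens_mult X F G) = vadd (dual (dual (dual X)))
        (dual_lact (bidual X) (?T F) (?D G)) (dual_ract (bidual X) (?D F) (?S G))"
    proof (rule extensionalityI)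
      show "?D (arens_mult X F G) \<in> extensional (vcarrier (dual (dual X)))"
        by (rule dual_extensional[OF D2[OF arens_mult_closed(1)[OF F G]]])
    qed (simp_all add: eval F G dual_lact_def dual_ract_def)
  qed
qed

text \<open>
  The restriction of \<open>\<Phi> \<in> B***\<close> to \<open>B\<close> is its image under the adjoint of the canonical
  embedding, which makes its boundedness automatic.
\<close>
lemma inner_restrict:
  assumes T: "bounded_linear_map X X T" and S: "bounded_linear_map X X S"
    and D: "bounded_linear_map X (dual X) D"
    and inner: "inner_TS_derivation (bidual X) (dual_bimodule (bidual X))
      (second_adjoint X X T) (second_adjoint X X S) (second_adjoint X (dual X) D)"
  shows "inner_TS_derivation X (dual_bimodule X) T S D"
proof -
  note ns = normed_space_axioms D.normed_space_axioms
  note k = bounded_linear_map_canonical_embedding[OF ns(1)]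
  note emb = bounded_linear_map_D(1)[OF k]
  note Tcl = bounded_linear_map_D(1)[OF T] and Scl = bounded_linear_map_D(1)[OF S]
    and Dcl = bounded_linear_map_D(1)[OF D]
  obtain \<Phi> where \<Phi>: "\<Phi> \<in> vcarrier (dual (dual (dual X)))"
    and inn: "\<And>F. F \<in> vcarrier (dual (dual X)) \<Longrightarrow> second_adjoint X (dual X) D F =
      vminus (dual_bimodule (bidual X)) (dual_lact (bidual X) (second_adjoint X X T F) \<Phi>)
        (dual_ract (bidual X) \<Phi> (second_adjoint X X S F))"
    using inner by (auto simp: inner_TS_derivation_def dual_bidual)
  define \<phi> where "\<phi> = adjoint X (dual (dual X)) (canonical_embedding X) \<Phi>"
  have \<phi>: "\<phi> \<in> vcarrier (dual X)"
    unfolding \<phi>_def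
    by (rule bounded_linear_map_D(1)[OF bounded_linear_map_adjoint[OF ns(1) DD.normed_space_axioms k] \<Phi>])
  have \<phi>_apply: "\<phi> c = \<Phi> (canonical_embedding X c)" if "c \<in> vcarrier X" for c
    by (simp add: \<phi>_def adjoint_apply \<Phi> that)
  have "D a = vminus (dual_bimodule X) (dual_lact X (T a) \<phi>) (dual_ract X \<phi> (S a))"
    if a: "a \<in> vcarrier X" for a
  proof (rule extensionalityI[of _ "vcarrier X"])
    show "D a \<in> extensional (vcarrier X)" by (rule dual_extensional[OF Dcl[OF a]])
    show "vminus (dual_bimodule X) (dual_lact X (T a) \<phi>) (dual_ract X \<phi> (S a)) \<in> extensional (vcarrier X)"
      by (simp add: vminus_def)
    fix c assume c: "c \<in> vcarrier X"
    have "D a c = second_adjoint X (dual X) D (canonical_embedding X a) (canonical_embedding X c)"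
      using emb[OF c] by (simp add: second_adjoint_canonical_embedding[OF ns D a] Dcl a)
    also have "\<dots> = \<Phi> (arens_mult X (canonical_embedding X c) (canonical_embedding X (T a)))
        - \<Phi> (arens_mult X (canonical_embedding X (S a)) (canonical_embedding X c))"
      unfolding inn[OF emb[OF a]] second_adjoint_canonical_embedding[OF ns(1) ns(1) T a]
        second_adjoint_canonical_embedding[OF ns(1) ns(1) S a]
      using emb[OF c] by (simp add: vminus_def dual_lact_def dual_ract_def)
    also have "\<dots> = \<phi> (amult X c (T a)) - \<phi> (amult X (S a) c)"
      by (simp add: canonical_embedding_mult \<phi>_apply mult_closed a c Tcl Scl)
    finally show "D a c = vminus (dual_bimodule X) (dual_lact X (T a) \<phi>) (dual_ract X \<phi> (S a)) c"
      using c by (simp add: vminus_def dual_lact_def dual_ract_def)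
  qed
  then show ?thesis using \<phi> by (auto simp: inner_TS_derivation_def)
qed

end

theorem mainTheorem1:
  fixes A :: "('k::real_normed_field, 'a) nalgebra"
    and B :: "('k, 'u) nalgebra"
    and n :: nat
    and T S :: "'u \<Rightarrow> 'u"
  assumes "banach_algebra A"
    and "even n"
    and "even_dual A n B"
    and "bounded_linear_map B B T"
    and "bounded_linear_map B B S"
    and "wstar_w_property B T (vcarrier (bidual B))"
    and "weakly_TS_amenable (bidual B) (second_adjoint B B T) (second_adjoint B B S)"
  shows "weakly_TS_amenable B T S"
proof -
  interpret B: normed_algebra B
    using even_dual_normed_algebra[OF assms(3)] assms(1) by (simp add: banach_algebra_def)
  show ?thesis
    unfolding weakly_TS_amenable_def
  proof (intro allI impI)
    fix D assume der: "TS_derivation B (dual_bimodule B) T S D"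
    then have "bounded_linear_map B (dual B) D"
      by (simp add: TS_derivation_def bounded_linear_map_dual_bimodule)
    moreover have "inner_TS_derivation (bidual B) (dual_bimodule (bidual B))
        (second_adjoint B B T) (second_adjoint B B S) (second_adjoint B (dual B) D)"
      using assms(7) B.second_adjoint_derivation[OF assms(4-6) der]
      by (simp add: weakly_TS_amenable_def)
    ultimately show "inner_TS_derivation B (dual_bimodule B) T S D"
      by (rule B.inner_restrict[OF assms(4,5)])
  qed
qed

end
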